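(* Let $c \geq 0$ be an integer and let $q, r, s$ be pairwise distinct odd primes. Then each of the following numbers is pristine: (i) $2^c$; (ii) $2^c q$, provided $q = c+2$; (iii) $2^c q r$, provided $q r = c^2 + 6c + 6$; (iv) $2^c q^2$, provided $q^2 = (c^2 + 7c + 8)/2$; (v) $2^c q r s$, provided $q r s = c^3 + 12c^2 + 36c + 26$; (vi) $2^c q^2 r$, provided $q^2 r = (c^3 + 13c^2 + 42c + 32)/2$.
   Context: For positive integers, write $m \lfloor n$ to mean that $m$ is a proper divisor of $n$. The number of recursive divisors is defined by $a(1)=1$ and $a(n) = 1 + \sum_{m \lfloor n} a(m)$ for $n>1$. A positive integer $n$ is pristine if $a(n) = n$. *)

theory Defs
  imports Complex_Main "HOL-Computational_Algebra.Primes"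
begin

definition proper_dvd :: "nat \<Rightarrow> nat \<Rightarrow> bool"  (infix "proper'_dvd" 50) where
  "m proper_dvd n \<longleftrightarrow> m dvd n \<and> m \<noteq> n"

(* The value at 0 is a dummy; only positive arguments are meaningful. *)
function recursive_divisors :: "nat \<Rightarrow> nat" where
  "recursive_divisors n =
     (if n \<le> 1 then 1 else 1 + (\<Sum>m | m proper_dvd n. recursive_divisors m))"
  by auto
termination
proof (relation "measure id")
  fix n m :: nat
  assume "\<not> n \<le> 1" and "m \<in> {m. m proper_dvd n}"
  then have "m dvd n" "m \<noteq> n" "n > 0"
    by (auto simp: proper_dvd_def)
  then show "(m, n) \<in> measure id"
    by (auto dest: dvd_imp_le)
qed auto

declare recursive_divisors.simps [simp del]

definition pristine :: "nat \<Rightarrow> bool" where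
  "pristine n \<longleftrightarrow> n > 0 \<and> recursive_divisors n = n"

end

theory Submission
  imports Defs
begin

text \<open>
  Summing over all divisors instead of the proper ones gives
  \<open>2 * a n = 1 + (\<Sum>d | d dvd n. a d)\<close> for every \<open>n > 0\<close>. Subtracting two instances of this for a
  prime \<open>p\<close> not dividing \<open>m\<close> yields
  \<open>2 * a (p ^ (c + 1) * m) = 2 * a (p ^ c * m) + (\<Sum>d | d dvd m. a (p ^ (c + 1) * d))\<close>.
  By induction on \<open>c\<close>, \<open>a (p ^ c * m)\<close> is then \<open>2 ^ c\<close> times a polynomial in \<open>c\<close> that depends only
  on the prime signature of \<open>m\<close>; the conditions of the theorem equate that polynomial with \<open>m\<close>
  for \<open>p = 2\<close>.
\<close>

section \<open>Divisor sums and the recursion in the exponent of one prime\<close>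

lemma prime_dvd_prime_iff: "prime p \<Longrightarrow> prime q \<Longrightarrow> p dvd q \<longleftrightarrow> p = q" for p q :: nat
  by (auto intro: primes_dvd_imp_eq)

lemma recursive_divisors_sum:
  assumes "n > 0"
  shows "2 * recursive_divisors n = 1 + (\<Sum>d | d dvd n. recursive_divisors d)"
proof -
  have fin: "finite {d. d dvd n}"
    using assms by simp
  have *: "{d. d dvd n} - {n} = {d. d proper_dvd n}"
    by (auto simp: proper_dvd_def)
  \<comment> \<open>The recursive equation also covers n = 1: there are no proper divisors, so the
    empty sum leaves 1.\<close>
  have "recursive_divisors n = 1 + (\<Sum>d | d proper_dvd n. recursive_divisors d)"
  proof (cases "n = 1")
    case True
    then show ?thesis
      by (simp add: recursive_divisors.simps[of "Suc 0"] proper_dvd_def)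
  next
    case False
    with assms show ?thesis
      by (subst recursive_divisors.simps) simp
  qed
  moreover have "(\<Sum>d | d dvd n. recursive_divisors d) =
      recursive_divisors n + (\<Sum>d | d proper_dvd n. recursive_divisors d)"
    using sum.remove[OF fin, of n recursive_divisors] by (simp add: *)
  ultimately show ?thesis
    by simp
qed

text \<open>The divisors d split by whether \<open>p ^ Suc k\<close> divides d. If it does,
  cancelling it leaves a divisor of m; otherwise the p-part of d is at most \<open>p ^ k\<close>, so
  d already divides \<open>p ^ k * m\<close>.\<close>

lemma sum_divisors_prime_power:
  fixes f :: "nat \<Rightarrow> nat"
  assumes p: "prime p" and m: "\<not> p dvd m"
  shows "(\<Sum>d | d dvd p ^ Suc k * m. f d) =
    (\<Sum>d | d dvd p ^ k * m. f d) + (\<Sum>d | d dvd m. f (p ^ Suc k * d))"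
proof -
  let ?g = "\<lambda>d. p ^ Suc k * d"
  have m0: "m > 0"
    using m by (cases m) auto
  have p0: "p > 0"
    using p by (rule prime_gt_0_nat)
  have "d dvd p ^ k * m \<or> d \<in> ?g ` {d. d dvd m}" if d: "d dvd p ^ Suc k * m" for d
  proof (cases "p ^ Suc k dvd d")
    case True
    then obtain e where "d = p ^ Suc k * e" ..
    with d p0 show ?thesis
      by auto
  next
    case False
    obtain x y where xy: "d = x * y" "x dvd p ^ Suc k" "y dvd m"
      using d by (rule dvd_productE)
    then obtain i where i: "i \<le> Suc k" "x = p ^ i"
      using divides_primepow_nat[OF p] by blast
    with False xy have "i \<noteq> Suc k"
      by auto
    with i have "x dvd p ^ k"
      by (simp add: le_imp_power_dvd)
    with xy show ?thesis
      by (simp add: mult_dvd_mono)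
  qed
  then have split: "{d. d dvd p ^ Suc k * m} = {d. d dvd p ^ k * m} \<union> ?g ` {d. d dvd m}"
    by (auto simp: mult.assoc)
  \<comment> \<open>The two classes are disjoint: cancelling \<open>p ^ k\<close> would leave p * e
    dividing m, against the choice of m.\<close>
  have "\<not> p ^ Suc k * e dvd p ^ k * m" for e
  proof
    assume "p ^ Suc k * e dvd p ^ k * m"
    then have "p ^ k * (p * e) dvd p ^ k * m"
      by (simp add: mult_ac)
    then show False
      using m p0 by (auto dest: dvd_mult_left)
  qed
  then have disj: "{d. d dvd p ^ k * m} \<inter> ?g ` {d. d dvd m} = {}"
    by auto
  have inj: "inj_on ?g {d. d dvd m}"
    using p0 by (auto simp: inj_on_def)
  show ?thesis
    unfolding split using m0 p0 disj
    by (subst sum.union_disjoint) (simp_all add: sum.reindex[OF inj] del: power_Suc)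
qed

lemma recursive_divisors_prime_power_step:
  assumes "prime p" "\<not> p dvd m"
  shows "2 * recursive_divisors (p ^ Suc c * m) =
    2 * recursive_divisors (p ^ c * m) + (\<Sum>d | d dvd m. recursive_divisors (p ^ Suc c * d))"
proof -
  have pos: "p ^ k * m > 0" for k
    using assms prime_gt_0_nat[of p] by (cases m) auto
  show ?thesis
    using recursive_divisors_sum[OF pos[of "Suc c"]] recursive_divisors_sum[OF pos[of c]]
      sum_divisors_prime_power[OF assms, of recursive_divisors c]
    by linarith
qed

lemma sum_divisors_prime_mult:
  fixes f :: "nat \<Rightarrow> nat"
  assumes "prime p" "\<not> p dvd m"
  shows "(\<Sum>d | d dvd p * m. f d) = (\<Sum>d | d dvd m. f d) + (\<Sum>d | d dvd m. f (p * d))"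
  using sum_divisors_prime_power[OF assms, of f 0] by simp

lemma sum_divisors_prime:
  fixes f :: "nat \<Rightarrow> nat"
  assumes "prime p"
  shows "(\<Sum>d | d dvd p. f d) = f 1 + f p"
  using sum_divisors_prime_mult[of p 1 f] assms prime_gt_1_nat[OF assms] by simp

lemma sum_divisors_prime_square:
  fixes f :: "nat \<Rightarrow> nat"
  assumes "prime p"
  shows "(\<Sum>d | d dvd p\<^sup>2. f d) = f 1 + f p + f (p\<^sup>2)"
  using sum_divisors_prime_power[of p 1 f 1] sum_divisors_prime[of p f] assms prime_gt_1_nat[OF assms]
  by (simp add: power2_eq_square)

section \<open>Closed forms by prime signature\<close>

lemma recursive_divisors_1: "recursive_divisors 1 = 1"
  by (simp add: recursive_divisors.simps)

text \<open>The divisor d = m in the step formula repeats the value sought. Moving it to the left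
  shows that the value at c + 1 is twice the value at c plus a sum over proper divisors of m. For m
  = 1 that sum is empty, leaving pure doubling.\<close>

lemma recursive_divisors_prime_power:
  assumes "prime p"
  shows "recursive_divisors (p ^ c) = 2 ^ c"
proof (induction c)
  case 0
  show ?case by (simp add: recursive_divisors_1[simplified])
next
  case (Suc c)
  then show ?case
    using recursive_divisors_prime_power_step[of p 1 c] assms prime_gt_1_nat[OF assms] by simp
qed

lemma recursive_divisors_prime: "prime p \<Longrightarrow> recursive_divisors p = 2"
  using recursive_divisors_prime_power[of p 1] by simp

lemma recursive_divisors_signature_1:
  assumes "prime p" "prime q" "p \<noteq> q"
  shows "recursive_divisors (p ^ c * q) = 2 ^ c * (c + 2)"
proof (induction c)
  case 0
  show ?case
    using assms by (simp add: recursive_divisors_prime)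
next
  case (Suc c)
  have "\<not> p dvd q"
    using assms by (simp add: prime_dvd_prime_iff)
  from recursive_divisors_prime_power_step[OF assms(1) this, of c]
  show ?case
    using assms Suc recursive_divisors_prime_power[of p "Suc c"]
    by (simp add: sum_divisors_prime algebra_simps)
qed

lemma recursive_divisors_signature_11:
  assumes "prime p" "prime q" "prime r" "distinct [p, q, r]"
  shows "recursive_divisors (p ^ c * (q * r)) = 2 ^ c * (c\<^sup>2 + 6 * c + 6)"
proof (induction c)
  case 0
  \<comment> \<open>Without p, the number q * r is itself an instance of the previous signature,
    with q as base prime and exponent 1: 2 * (1 + 2) = 6.\<close>
  show ?case
    using recursive_divisors_signature_1[of q r 1] assms by simp
next
  case (Suc c)
  have "\<not> p dvd q * r" "\<not> q dvd r"
    using assms by (auto simp: prime_dvd_mult_iff prime_dvd_prime_iff)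
  with recursive_divisors_prime_power_step[OF assms(1) this(1), of c]
  show ?case
    using assms Suc recursive_divisors_prime_power[of p "Suc c"]
      recursive_divisors_signature_1[of p q "Suc c"]
      recursive_divisors_signature_1[of p r "Suc c"]
    by (simp add: sum_divisors_prime_mult sum_divisors_prime algebra_simps power2_eq_square)
qed

text \<open>The formula is kept doubled so that no division by 2 occurs in the naturals.\<close>

lemma recursive_divisors_signature_2:
  assumes "prime p" "prime q" "p \<noteq> q"
  shows "2 * recursive_divisors (p ^ c * q\<^sup>2) = 2 ^ c * (c\<^sup>2 + 7 * c + 8)"
proof (induction c)
  case 0
  show ?case
    using assms by (simp add: recursive_divisors_prime_power)
next
  case (Suc c)
  have "\<not> p dvd q\<^sup>2"
    using assms by (auto simp: prime_dvd_power_iff prime_dvd_prime_iff)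
  note step = recursive_divisors_prime_power_step[OF assms(1) this, of c,
      unfolded sum_divisors_prime_square[OF assms(2)]]
  show ?case
    using step assms Suc recursive_divisors_prime_power[of p "Suc c"]
      recursive_divisors_signature_1[of p q "Suc c"]
    by (simp add: algebra_simps power2_eq_square)
qed

text \<open>Passing from c to c + 1 adds to the polynomial the terms of the proper divisors of q * r
  * s: one for 1, three for single primes and three for products of two. The constant is 26 = 2 * (1
  + 6 + 6).\<close>

lemma recursive_divisors_signature_111:
  assumes "prime p" "prime q" "prime r" "prime s" "distinct [p, q, r, s]"
  shows "recursive_divisors (p ^ c * (q * (r * s))) = 2 ^ c * (c ^ 3 + 12 * c\<^sup>2 + 36 * c + 26)"
proof (induction c)
  case 0
  show ?case
    using recursive_divisors_signature_11[of q r s 1] assms by simp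
next
  case (Suc c)
  have "\<not> p dvd q * (r * s)" "\<not> q dvd r * s" "\<not> r dvd s"
    using assms by (auto simp: prime_dvd_mult_iff prime_dvd_prime_iff)
  with recursive_divisors_prime_power_step[OF assms(1) this(1), of c]
  show ?case
    using assms Suc recursive_divisors_prime_power[of p "Suc c"]
      recursive_divisors_signature_1[of p q "Suc c"]
      recursive_divisors_signature_1[of p r "Suc c"]
      recursive_divisors_signature_1[of p s "Suc c"]
      recursive_divisors_signature_11[of p q r "Suc c"]
      recursive_divisors_signature_11[of p q s "Suc c"]
      recursive_divisors_signature_11[of p r s "Suc c"]
    by (simp add: sum_divisors_prime_mult sum_divisors_prime algebra_simps
        power2_eq_square power3_eq_cube)
qed

lemma recursive_divisors_signature_21:
  assumes "prime p" "prime q" "prime r" "distinct [p, q, r]"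
  shows "2 * recursive_divisors (p ^ c * (r * q\<^sup>2)) =
    2 ^ c * (c ^ 3 + 13 * c\<^sup>2 + 42 * c + 32)"
proof (induction c)
  case 0
  \<comment> \<open>Here q is the base prime with exponent 2, giving 4 * (2 + 2) = 16, hence 32
    after doubling.\<close>
  show ?case
    using recursive_divisors_signature_1[of q r 2] assms by (simp add: mult.commute)
next
  case (Suc c)
  have p: "\<not> p dvd r * q\<^sup>2" and r: "\<not> r dvd q\<^sup>2"
    using assms by (auto simp: prime_dvd_mult_iff prime_dvd_power_iff prime_dvd_prime_iff)
  note step = recursive_divisors_prime_power_step[OF assms(1) p, of c,
      unfolded sum_divisors_prime_mult[OF assms(3) r] sum_divisors_prime_square[OF assms(2)]]
  show ?case
    using step assms Suc recursive_divisors_prime_power[of p "Suc c"]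
      recursive_divisors_signature_1[of p q "Suc c"]
      recursive_divisors_signature_1[of p r "Suc c"]
      recursive_divisors_signature_11[of p r q "Suc c"]
      recursive_divisors_signature_2[of p q "Suc c"]
    by (simp add: algebra_simps power2_eq_square power3_eq_cube)
qed

theorem theorem4:
  fixes c q r s :: nat
  assumes "prime q" "odd q" and "prime r" "odd r" and "prime s" "odd s"
    and "q \<noteq> r" "q \<noteq> s" "r \<noteq> s"
  shows "pristine (2 ^ c) \<and>
    (q = c + 2 \<longrightarrow> pristine (2 ^ c * q)) \<and>
    (q * r = c\<^sup>2 + 6 * c + 6 \<longrightarrow> pristine (2 ^ c * q * r)) \<and>
    (real (q\<^sup>2) = (real c ^ 2 + 7 * real c + 8) / 2 \<longrightarrow> pristine (2 ^ c * q\<^sup>2)) \<and>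
    (q * r * s = c ^ 3 + 12 * c\<^sup>2 + 36 * c + 26 \<longrightarrow> pristine (2 ^ c * q * r * s)) \<and>
    (real (q\<^sup>2 * r) = (real c ^ 3 + 13 * real c ^ 2 + 42 * real c + 32) / 2 \<longrightarrow>
      pristine (2 ^ c * q\<^sup>2 * r))"
proof (intro conjI impI)
  note [simp] = assms(1,3,5)
  \<comment> \<open>Oddness is what allows p = 2 in the closed forms.\<close>
  have two: "2 \<noteq> q" "2 \<noteq> r" "2 \<noteq> s"
    using assms(2,4,6) by auto
  have pos: "q > 0" "r > 0" "s > 0"
    by (simp_all add: prime_gt_0_nat)
  show "pristine (2 ^ c)"
    by (simp add: pristine_def recursive_divisors_prime_power)
  show "pristine (2 ^ c * q)" if "q = c + 2"
    using recursive_divisors_signature_1[of 2 q c] two pos assms(1)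
    by (simp only: that[symmetric]) (simp add: pristine_def)
  show "pristine (2 ^ c * q * r)" if "q * r = c\<^sup>2 + 6 * c + 6"
    using recursive_divisors_signature_11[of 2 q r c] two pos assms(7) that
    by (simp add: pristine_def mult.assoc)
  show "pristine (2 ^ c * q\<^sup>2)" if "real (q\<^sup>2) = (real c ^ 2 + 7 * real c + 8) / 2"
  proof -
    \<comment> \<open>Clearing the denominator makes both sides casts of naturals, so the condition
      matches the doubled closed form.\<close>
    have "real (2 * q\<^sup>2) = real (c\<^sup>2 + 7 * c + 8)"
      using that by simp
    then have "2 * q\<^sup>2 = c\<^sup>2 + 7 * c + 8"
      by (simp only: of_nat_eq_iff)
    then show ?thesis
      using recursive_divisors_signature_2[of 2 q c] two pos
      by (simp add: pristine_def flip: \<open>2 * q\<^sup>2 = _\<close>)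
  qed
  show "pristine (2 ^ c * q * r * s)" if "q * r * s = c ^ 3 + 12 * c\<^sup>2 + 36 * c + 26"
    using recursive_divisors_signature_111[of 2 q r s c] two pos assms(7-9) that
    by (simp add: pristine_def mult.assoc)
  show "pristine (2 ^ c * q\<^sup>2 * r)"
    if "real (q\<^sup>2 * r) = (real c ^ 3 + 13 * real c ^ 2 + 42 * real c + 32) / 2"
  proof -
    have "real (2 * (r * q\<^sup>2)) = real (c ^ 3 + 13 * c\<^sup>2 + 42 * c + 32)"
      using that by (simp add: mult.commute)
    then have eq: "2 * (r * q\<^sup>2) = c ^ 3 + 13 * c\<^sup>2 + 42 * c + 32"
      by (simp only: of_nat_eq_iff)
    have "2 * recursive_divisors (2 ^ c * (r * q\<^sup>2)) = 2 ^ c * (2 * (r * q\<^sup>2))"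
      unfolding eq using recursive_divisors_signature_21[of 2 q r c] two assms(7) by simp
    then show ?thesis
      using pos by (simp add: pristine_def mult_ac)
  qed
qed

end
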